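(* For every $\varepsilon>0$ there is a constant $C$ such that for all sufficiently large $n$, \[ \mathrm{rex}(n, K_{3,3}) \geq \frac{1}{2 \sqrt[3]{14^2}}\, n^{5/3} - C n^{8/5+\varepsilon}. \]
   Context: All graphs are finite and simple. For a graph $F$, $\mathrm{rex}(n,F)$ denotes the maximum number of edges in an $n$-vertex graph that is regular and contains no subgraph isomorphic to $F$. $K_{3,3}$ is the complete bipartite graph with both parts of size $3$. *)

theory Defs
  imports Complex_Main
begin

type_synonym 'a graph = "'a set \<times> 'a set set"

abbreviation verts :: "'a graph \<Rightarrow> 'a set" where
  "verts G \<equiv> fst G"

abbreviation edges :: "'a graph \<Rightarrow> 'a set set" where
  "edges G \<equiv> snd G"

definition simple_graph :: "'a graph \<Rightarrow> bool" where
  "simple_graph G \<longleftrightarrow> finite (verts G) \<and> (\<forall>e\<in>edges G. e \<subseteq> verts G \<and> card e = 2)"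

definition degree :: "'a graph \<Rightarrow> 'a \<Rightarrow> nat" where
  "degree G v = card {e \<in> edges G. v \<in> e}"

definition regular :: "'a graph \<Rightarrow> bool" where
  "regular G \<longleftrightarrow> (\<exists>d. \<forall>v\<in>verts G. degree G v = d)"

definition subgraph :: "'a graph \<Rightarrow> 'a graph \<Rightarrow> bool" where
  "subgraph H G \<longleftrightarrow> simple_graph H \<and> verts H \<subseteq> verts G \<and> edges H \<subseteq> edges G"

definition isomorphic :: "'a graph \<Rightarrow> 'b graph \<Rightarrow> bool" where
  "isomorphic G H \<longleftrightarrow> (\<exists>f. bij_betw f (verts G) (verts H) \<and>
     (\<forall>u\<in>verts G. \<forall>v\<in>verts G. {u, v} \<in> edges G \<longleftrightarrow> {f u, f v} \<in> edges H))"

definition contains_copy :: "'a graph \<Rightarrow> 'b graph \<Rightarrow> bool" where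
  "contains_copy G F \<longleftrightarrow> (\<exists>H. subgraph H G \<and> isomorphic H F)"

definition complete_bipartite :: "nat \<Rightarrow> nat \<Rightarrow> (nat + nat) graph" where
  "complete_bipartite s t =
     ({..<s} <+> {..<t}, {{Inl i, Inr j} | i j. i < s \<and> j < t})"

text \<open>Every finite graph has an isomorphic copy with vertices in \<^typ>\<open>nat\<close>, so this
  quantifies over all \<open>n\<close>-vertex graphs up to isomorphism. The \<^const>\<open>Max\<close> in
  \<open>rex\<close> is over a finite set (\<open>finite_rex_candidates\<close>), which contains the
  edgeless graph on \<open>n\<close> vertices unless \<open>F\<close> has no edges; for edgeless
  \<open>F\<close> the set may be empty and \<^const>\<open>Max\<close> is then unspecified.\<close>

definition rex_candidates :: "nat \<Rightarrow> 'b graph \<Rightarrow> nat graph set" where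
  "rex_candidates n F =
     {G. simple_graph G \<and> card (verts G) = n \<and> regular G \<and> \<not> contains_copy G F}"

definition rex :: "nat \<Rightarrow> 'b graph \<Rightarrow> nat" where
  "rex n F = Max ((\<lambda>G. card (edges G)) ` rex_candidates n F)"

lemma finite_rex_candidates: "finite ((\<lambda>G. card (edges G)) ` rex_candidates n F)"
proof (rule finite_subset)
  show "(\<lambda>G. card (edges G)) ` rex_candidates n F \<subseteq> {..2 ^ n}"
  proof clarsimp
    fix V :: "nat set" and E assume "(V, E) \<in> rex_candidates n F"
    then have "finite V" "card V = n" "E \<subseteq> Pow V"
      by (auto simp: rex_candidates_def simple_graph_def)
    then show "card E \<le> 2 ^ n"
      using card_mono[of "Pow V" E] by (simp add: card_Pow)
  qed
qed simp

lemma rex_candidates_nonempty: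
  assumes "simple_graph F" "edges F \<noteq> {}"
  shows "rex_candidates n F \<noteq> {}"
proof -
  have "\<not> contains_copy ({..<n}, {}) F"
  proof
    assume "contains_copy ({..<n}, {}) F"
    then obtain H :: "nat graph" and f where H: "edges H = {}"
      and f: "bij_betw f (verts H) (verts F)"
      and e: "\<forall>u\<in>verts H. \<forall>v\<in>verts H. {u, v} \<in> edges H \<longleftrightarrow> {f u, f v} \<in> edges F"
      by (auto simp: contains_copy_def subgraph_def isomorphic_def)
    from assms obtain x y where xy: "{x, y} \<in> edges F" "x \<in> verts F" "y \<in> verts F"
      unfolding simple_graph_def card_2_iff by (metis all_not_in_conv insert_subset)
    then obtain u v where "u \<in> verts H" "v \<in> verts H" "f u = x" "f v = y"
      using f by (metis bij_betw_imp_surj_on imageE)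
    then show False using e H xy by auto
  qed
  then have "({..<n}, {}) \<in> rex_candidates n F"
    by (auto simp: rex_candidates_def simple_graph_def regular_def degree_def)
  then show ?thesis by blast
qed

end

theory Submission
  imports Defs "HOL-Algebra.Algebraic_Closure_Type" "HOL-Algebra.Multiplicative_Group" "HOL-Library.Z2"
begin

text \<open>Let \<open>q\<close> be a power of two and let \<open>g\<close> generate the multiplicative group of the field with
  \<open>q\<^sup>2\<close> elements. On pairs \<open>(x, a)\<close> with \<open>x\<close> in that group and \<open>a\<close> in the field with \<open>q\<close>
  elements, the relation \<open>N(x y + 1) = a + b\<close> (with \<open>N\<close> the norm) contains no \<open>K\<^sub>3\<^sub>,\<^sub>3\<close>, since no
  three points of an elliptic paraboloid are collinear. Writing \<open>x = g\<^sup>i\<close> and lifting the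
  exponents \<open>i\<close> from residues modulo \<open>q\<^sup>2 - 1\<close> to residues modulo any \<open>M \<ge> 2 (q\<^sup>2 - 1)\<close> keeps the
  relation free of \<open>K\<^sub>3\<^sub>,\<^sub>3\<close>. Keeping only \<open>L\<close> values of \<open>a\<close>, and edges between distinct values,
  gives a regular loopless graph on \<open>L M\<close> vertices whose degree can be any \<open>(L - 1) c\<close> with
  \<open>c \<le> q\<close>. Every large \<open>n\<close> is of the form \<open>L M\<^sub>1 + (L + 1) M\<^sub>2\<close>, so a disjoint union of two such
  graphs of equal degree has \<open>n\<close> vertices. The lifting and the splitting each double the number
  of vertices, which costs a factor of only \<open>4\<close> instead of the available \<open>14\<close>; the surplus absorbs
  the sparsity of the powers of two.\<close>

section \<open>Roots of unity in characteristic \<open>p\<close>\<close>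

text \<open>A simple root \<open>a\<close> is not a root of the cofactor left after splitting off
  the factor X - a, so each step of the induction on the degree loses exactly one root.\<close>

lemma card_roots_separable:
  fixes p :: "'a :: alg_closed_field poly"
  assumes "p \<noteq> 0" "\<And>x. poly p x = 0 \<Longrightarrow> poly (pderiv p) x \<noteq> 0"
  shows "card {x. poly p x = 0} = degree p"
  using assms
proof (induction "degree p" arbitrary: p)
  case 0
  then obtain c where "p = [:c:]" "c \<noteq> 0"
    by (metis degree_eq_zeroE pCons_0_0)
  then show ?case by simp
next
  case (Suc n)
  then obtain a where a: "poly p a = 0"
    using alg_closed_imp_poly_has_root by (metis zero_less_Suc)
  then obtain r where r: "p = [:-a, 1:] * r"
    using poly_eq_0_iff_dvd by (metis dvdE)
  have d: "poly (pderiv p) x = poly r x + (x - a) * poly (pderiv r) x" for x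
    unfolding r pderiv_mult by (simp add: pderiv_pCons algebra_simps)
  have "r \<noteq> 0" using r Suc.prems by auto
  then have "degree p = Suc (degree r)" unfolding r by (subst degree_mult_eq) auto
  moreover have "poly (pderiv r) x \<noteq> 0" if "poly r x = 0" for x
    using Suc.prems(2)[of x] that d[of x] by (auto simp: r)
  ultimately have IH: "card {x. poly r x = 0} = degree r"
    using Suc.hyps(1)[of r] Suc.hyps(2) \<open>r \<noteq> 0\<close> by simp
  have "poly r a \<noteq> 0" using Suc.prems(2)[OF a] d[of a] by simp
  moreover have "{x. poly p x = 0} = insert a {x. poly r x = 0}" by (auto simp: r)
  ultimately show ?case
    using IH \<open>degree p = _\<close> poly_roots_finite[OF \<open>r \<noteq> 0\<close>] by simp
qed

text \<open>The derivative of X^n - c is n X^(n-1), which vanishes only at 0, and 0 is not a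
  root.\<close>

lemma card_power_eq:
  fixes c :: "'a :: alg_closed_field"
  assumes "c \<noteq> 0" "of_nat n \<noteq> (0 :: 'a)"
  shows "card {x. x ^ n = c} = n"
proof -
  let ?p = "monom 1 n - [:c:]"
  have n: "n > 0" using assms(2) by (metis of_nat_0 gr0I)
  have deg: "degree ?p = n"
    using n by (simp add: diff_conv_add_uminus degree_add_eq_left degree_monom_eq del: add_uminus_conv_diff)
  have p: "poly ?p x = x ^ n - c" for x by (simp add: poly_monom)
  have "poly (pderiv ?p) x \<noteq> 0" if "poly ?p x = 0" for x
  proof -
    have "x \<noteq> 0" using that assms n by (auto simp: poly_monom)
    then show ?thesis using assms(2) by (simp add: pderiv_diff pderiv_monom poly_monom pderiv_pCons)
  qed
  then have "card {x. poly ?p x = 0} = n"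
    using card_roots_separable[of ?p] deg n by fastforce
  then show ?thesis by (simp add: poly_monom)
qed

lemma CHAR_bit: "CHAR(bit) = 2"
proof (rule CHAR_eqI)
  show "of_nat 2 = (0 :: bit)" by simp
  fix n assume "of_nat n = (0 :: bit)"
  then show "2 dvd n" by (metis even_of_nat_iff even_zero)
qed


text \<open>Fixed points of a power of Frobenius form a field, and a finite field has cyclic
  multiplicative group. The record \<open>R\<close> presents \<open>K\<close> as a ring with
  explicit carrier, as that theorem requires.\<close>

lemma power_char_power_fixed_generator:
  fixes m :: nat
  assumes p: "prime CHAR('a :: alg_closed_field)"
  defines "K \<equiv> {x :: 'a. x ^ (CHAR('a) ^ m) = x}"
  assumes "finite K"
  shows "\<exists>g. K - {0} = range (\<lambda>i. g ^ i)"
proof -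
  let ?q = "CHAR('a) ^ m"
  have q: "?q > 0" using p prime_gt_0_nat by simp
  define R :: "'a ring" where
    "R = \<lparr>carrier = K, monoid.mult = (*), one = 1, zero = 0, add = (+)\<rparr>"
  \<comment> \<open>Expanding (x + (-x))^q avoids a case distinction on the parity of the
    characteristic.\<close>
  have minus: "- x \<in> K" if "x \<in> K" for x
  proof -
    have "(x + (- x)) ^ ?q = x ^ ?q + (- x) ^ ?q"
      by (rule freshmans_dream'[OF p]) simp
    then have "x + (- x) ^ ?q = 0" using that by (simp add: K_def zero_power[OF q] del: power_eq_0_iff)
    then show ?thesis by (simp add: K_def eq_neg_iff_add_eq_0 add.commute)
  qed
  have "cring R"
  proof (unfold_locales; (simp add: R_def K_def algebra_simps power_mult_distrib; fail)?)
    fix x y assume "x \<in> carrier (add_monoid R)" "y \<in> carrier (add_monoid R)"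
    then show "x \<otimes>\<^bsub>add_monoid R\<^esub> y \<in> carrier (add_monoid R)"
      using freshmans_dream'[OF p, of ?q m x y] by (simp add: R_def K_def)
  next
    show "carrier (add_monoid R) \<subseteq> Units (add_monoid R)"
    proof
      fix x assume "x \<in> carrier (add_monoid R)"
      then show "x \<in> Units (add_monoid R)"
        using minus[of x] unfolding Units_def by (auto simp: R_def intro!: bexI[of _ "-x"])
    qed
  next
    show "\<one>\<^bsub>add_monoid R\<^esub> \<in> carrier (add_monoid R)"
      using prime_gt_0_nat[OF p] by (simp add: R_def K_def)
  qed
  moreover have "Units R = carrier R - {\<zero>\<^bsub>R\<^esub>}"
  proof -
    have "x \<in> K - {0} \<longleftrightarrow> x \<in> K \<and> (\<exists>y\<in>K. y * x = 1 \<and> x * y = 1)" for x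
    proof (cases "x \<in> K - {0}")
      case True
      then have "inverse x \<in> K" by (simp add: K_def power_inverse)
      then show ?thesis using True by (auto intro!: bexI[of _ "inverse x"])
    qed auto
    then show ?thesis by (auto simp: R_def Units_def)
  qed
  ultimately have "field R" by (intro cring.cring_fieldI)
  moreover have "finite (carrier R)" using \<open>finite K\<close> by (simp add: R_def)
  ultimately obtain g where g: "carrier (Multiplicative_Group.mult_of R) = {g [^]\<^bsub>R\<^esub> i | i::nat. i \<in> UNIV}"
    using field.finite_field_mult_group_has_gen \<open>finite (carrier R)\<close> by blast
  have "g [^]\<^bsub>R\<^esub> i = g ^ i" for i :: nat
    by (induction i) (simp_all add: R_def nat_pow_def)
  with g show ?thesis by (intro exI[of _ g]) (auto simp: R_def)
qed

section \<open>The norm relation\<close>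

text \<open>In dimension three, vectors orthogonal to both u and v are multiples of the cross
  product n of u and v. The last hypothesis says that its third or first coordinate is
  nonzero.\<close>

lemma orthogonal_pairs_dependent:
  fixes u1 :: "'a :: field"
  assumes "u1 * w1 + u2 * w2 + u3 * w3 = 0" "u1 * z1 + u2 * z2 + u3 * z3 = 0"
    and "v1 * w1 + v2 * w2 + v3 * w3 = 0" "v1 * z1 + v2 * z2 + v3 * z3 = 0"
    and "u1 * v2 \<noteq> u2 * v1 \<or> u2 * v3 \<noteq> u3 * v2"
  shows "w1 * z2 = w2 * z1" "w2 * z3 = w3 * z2"
proof -
  define n1 n2 n3 where "n1 = u2 * v3 - u3 * v2" and "n2 = u3 * v1 - u1 * v3"
    and "n3 = u1 * v2 - u2 * v1"
  \<comment> \<open>Coordinates of the double cross product: n x w = v (u . w) - u (v . w).\<close>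
  have cross: "n1 * b - n2 * a = v3 * (u1 * a + u2 * b + u3 * c) - u3 * (v1 * a + v2 * b + v3 * c)"
    "n2 * c - n3 * b = v1 * (u1 * a + u2 * b + u3 * c) - u1 * (v1 * a + v2 * b + v3 * c)"
    "n3 * a - n1 * c = v2 * (u1 * a + u2 * b + u3 * c) - u2 * (v1 * a + v2 * b + v3 * c)"
    for a b c
    unfolding n1_def n2_def n3_def by (simp_all add: algebra_simps)
  have w: "n1 * w2 = n2 * w1" "n2 * w3 = n3 * w2" "n3 * w1 = n1 * w3"
    using cross[where a = w1 and b = w2 and c = w3] assms(1,3) by simp_all
  have z: "n1 * z2 = n2 * z1" "n2 * z3 = n3 * z2" "n3 * z1 = n1 * z3"
    using cross[where a = z1 and b = z2 and c = z3] assms(2,4) by simp_all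
  have "n1 * n1 * (w1 * z2 - w2 * z1) = (n1 * w1) * (n1 * z2) - (n1 * w2) * (n1 * z1)"
    by (simp add: algebra_simps)
  then have "n1 * n1 * (w1 * z2 - w2 * z1) = 0"
    by (simp add: w(1) z(1) ac_simps)
  moreover have "n1 * n1 * (w2 * z3 - w3 * z2) = (n1 * w2) * (n1 * z3) - (n1 * w3) * (n1 * z2)"
    by (simp add: algebra_simps)
  then have "n1 * n1 * (w2 * z3 - w3 * z2) = 0"
    unfolding w(1) z(1) w(3)[symmetric] z(3)[symmetric] by (simp add: ac_simps)
  moreover have "n3 * n3 * (w1 * z2 - w2 * z1) = (n3 * w1) * (n3 * z2) - (n3 * w2) * (n3 * z1)"
    by (simp add: algebra_simps)
  then have "n3 * n3 * (w1 * z2 - w2 * z1) = 0"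
    unfolding w(2)[symmetric] z(2)[symmetric] w(3) z(3) by (simp add: ac_simps)
  moreover have "n3 * n3 * (w2 * z3 - w3 * z2) = (n3 * w2) * (n3 * z3) - (n3 * w3) * (n3 * z2)"
    by (simp add: algebra_simps)
  then have "n3 * n3 * (w2 * z3 - w3 * z2) = 0"
    unfolding w(2)[symmetric] z(2)[symmetric] by (simp add: ac_simps)
  moreover have "n1 \<noteq> 0 \<or> n3 \<noteq> 0" using assms(5) by (auto simp: n1_def n3_def)
  ultimately show "w1 * z2 = w2 * z1" "w2 * z3 = w3 * z2" by auto
qed

text \<open>\<open>eq1\<close> and \<open>eq2\<close> are two minors expressing collinearity of the
  points (x \<sigma>(x), x, \<sigma>(x)). The first plus \<open>x1\<close> times the second factors
  into three differences, none of them zero.\<close>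

lemma paraboloid_no_three_collinear:
  fixes \<sigma> :: "'a :: field \<Rightarrow> 'a"
  assumes \<sigma>: "\<And>x y. \<sigma> (x - y) = \<sigma> x - \<sigma> y" "inj \<sigma>"
    and "x1 \<noteq> x2" "x1 \<noteq> x3" "x2 \<noteq> x3"
    and eq1: "(x2 * \<sigma> x2 - x1 * \<sigma> x1) * (x3 - x1) = (x2 - x1) * (x3 * \<sigma> x3 - x1 * \<sigma> x1)"
    and eq2: "(x2 - x1) * (\<sigma> x3 - \<sigma> x1) = (\<sigma> x2 - \<sigma> x1) * (x3 - x1)"
  shows False
proof -
  have ne: "\<sigma> x2 \<noteq> \<sigma> x3" using assms by (auto dest: injD)
  have "(x2 - x1) * (x3 - x1) * (\<sigma> x2 - \<sigma> x3) = 0"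
  proof -
    have "(x2 - x1) * (x3 - x1) * (\<sigma> x2 - \<sigma> x3)
      = ((x2 * \<sigma> x2 - x1 * \<sigma> x1) * (x3 - x1) - (x2 - x1) * (x3 * \<sigma> x3 - x1 * \<sigma> x1))
        + x1 * ((x2 - x1) * (\<sigma> x3 - \<sigma> x1) - (\<sigma> x2 - \<sigma> x1) * (x3 - x1))"
      by (simp add: algebra_simps)
    then show ?thesis by (simp only: eq1 eq2) simp
  qed
  then show False using assms ne by simp
qed

text \<open>The second differences of the nine equations say that the two planes of differences of the
  points \<open>(x \<sigma>(x), x, \<sigma>(x))\<close> and \<open>(y \<sigma>(y), y, \<sigma>(y))\<close> are orthogonal, which is impossible in
  dimension three.\<close>

lemma norm_relation_no_K33:
  fixes \<sigma> :: "'a :: field \<Rightarrow> 'a" and x y a b :: "nat \<Rightarrow> 'a"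
  assumes \<sigma>: "\<And>x y. \<sigma> (x - y) = \<sigma> x - \<sigma> y" "inj \<sigma>"
    and inj: "inj_on x {..<3}" "inj_on y {..<3}"
    and rel: "\<And>i j. i < 3 \<Longrightarrow> j < 3 \<Longrightarrow> (x i * y j + 1) * (\<sigma> (x i) * \<sigma> (y j) + 1) = a i + b j"
  shows False
proof -
  let ?P = "\<lambda>z. z * \<sigma> z"
  have orth: "(?P (x i) - ?P (x 0)) * (?P (y j) - ?P (y 0)) + (x i - x 0) * (y j - y 0)
      + (\<sigma> (x i) - \<sigma> (x 0)) * (\<sigma> (y j) - \<sigma> (y 0)) = 0" if "i < 3" "j < 3" for i j
  proof -
    let ?F = "\<lambda>i j. (x i * y j + 1) * (\<sigma> (x i) * \<sigma> (y j) + 1)"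
    have "(?P (x i) - ?P (x 0)) * (?P (y j) - ?P (y 0)) + (x i - x 0) * (y j - y 0)
      + (\<sigma> (x i) - \<sigma> (x 0)) * (\<sigma> (y j) - \<sigma> (y 0)) = ?F i j - ?F i 0 - ?F 0 j + ?F 0 0"
      by (simp add: algebra_simps)
    also have "\<dots> = 0" using that by (simp add: rel)
    finally show ?thesis .
  qed
  have xne: "x 0 \<noteq> x 1" "x 0 \<noteq> x 2" "x 1 \<noteq> x 2" and yne: "y 0 \<noteq> y 1" "y 0 \<noteq> y 2" "y 1 \<noteq> y 2"
    using inj_onD[OF inj(1), of 0 1] inj_onD[OF inj(1), of 0 2] inj_onD[OF inj(1), of 1 2]
      inj_onD[OF inj(2), of 0 1] inj_onD[OF inj(2), of 0 2] inj_onD[OF inj(2), of 1 2] by auto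
  have "(?P (x 1) - ?P (x 0)) * (x 2 - x 0) \<noteq> (x 1 - x 0) * (?P (x 2) - ?P (x 0)) \<or>
    (x 1 - x 0) * (\<sigma> (x 2) - \<sigma> (x 0)) \<noteq> (\<sigma> (x 1) - \<sigma> (x 0)) * (x 2 - x 0)"
    using paraboloid_no_three_collinear[OF \<sigma> xne] by blast
  from orthogonal_pairs_dependent[OF orth orth orth orth this]
  show False
    using paraboloid_no_three_collinear[OF \<sigma> yne] by simp
qed

lemma diff_power_char:
  fixes x y :: "'a :: comm_ring_1"
  assumes "prime CHAR('a)" "n = CHAR('a) ^ m"
  shows "(x - y) ^ n = x ^ n - y ^ n"
  using freshmans_dream'[OF assms, of "x - y" y] by (simp add: algebra_simps)

lemma inj_power_char:
  assumes "prime CHAR('a :: field)" "n = CHAR('a) ^ m"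
  shows "inj (\<lambda>x :: 'a. x ^ n)"
proof (rule injI)
  fix x y :: 'a assume "x ^ n = y ^ n"
  then have "(x - y) ^ n = 0" using diff_power_char[OF assms] by simp
  then show "x = y" by simp
qed

text \<open>The fields with q and q^2 elements are realised as fixed-point sets inside one
  algebraically closed field, so solutions of norm equations can be counted there before locating
  them in the smaller field.\<close>

locale quadratic_tower =
  fixes k q :: nat and g :: "'a :: alg_closed_field"
  assumes char2: "CHAR('a) = 2"
    and q_def: "q = 2 ^ k" and k_pos: "k > 0"
    and powers_g: "{x. x ^ (q\<^sup>2) = x} - {0} = range (\<lambda>i. g ^ i)"
begin

lemma q_power_char: "q = CHAR('a) ^ k" "q\<^sup>2 = CHAR('a) ^ (k * 2)"
  unfolding q_def char2 by (simp_all only: power_mult)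

lemma two_eq_0: "(2 :: 'a) = 0"
  using of_nat_CHAR[where ?'a = 'a] by (simp add: char2)

lemma q_ge_2: "q \<ge> 2"
  using k_pos by (cases k) (auto simp: q_def)

lemma even_q: "of_nat q = (0 :: 'a)"
  using k_pos by (cases k) (auto simp: q_def two_eq_0)

lemma add_power_q: "(x + y :: 'a) ^ q = x ^ q + y ^ q" "(x + y :: 'a) ^ (q\<^sup>2) = x ^ (q\<^sup>2) + y ^ (q\<^sup>2)"
proof -
  have p: "prime CHAR('a)" by (simp add: char2)
  show "(x + y) ^ q = x ^ q + y ^ q" "(x + y) ^ (q\<^sup>2) = x ^ (q\<^sup>2) + y ^ (q\<^sup>2)"
    by (rule freshmans_dream'[OF p q_power_char(1)], rule freshmans_dream'[OF p q_power_char(2)])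
qed

definition subfield_q :: "'a set" where
  "subfield_q = {x. x ^ q = x}"

lemma add_self: "(x :: 'a) + x = 0"
  using two_eq_0 by (metis mult_2 mult_zero_left)

text \<open>Apart from 0 the solutions are the (n-1)-th roots of unity, and n - 1 is -1 in the
  field, hence nonzero.\<close>

lemma card_fixed_power:
  assumes "n \<ge> 2" "of_nat n = (0 :: 'a)"
  shows "card {x :: 'a. x ^ n = x} = n"
proof -
  have "card {x :: 'a. x ^ (n - 1) = 1} = n - 1"
    using assms by (intro card_power_eq) (auto simp: of_nat_diff)
  moreover have "{x :: 'a. x ^ n = x} = insert 0 {x. x ^ (n - 1) = 1}"
    using assms(1) by (cases n) (auto simp: power_0_left)
  moreover have "finite {x :: 'a. x ^ (n - 1) = 1}"
    using calculation(1) assms(1) by (intro card_ge_0_finite) simp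
  moreover have "(0 :: 'a) \<notin> {x. x ^ (n - 1) = 1}" using assms(1) by (simp add: power_0_left)
  ultimately have "card {x :: 'a. x ^ n = x} = Suc (n - 1)" by (simp del: mem_Collect_eq)
  then show ?thesis using assms(1) by simp
qed

lemma card_subfield_q: "card subfield_q = q"
  unfolding subfield_q_def using card_fixed_power[of q] q_ge_2 even_q by blast

lemma q2_ge: "q\<^sup>2 \<ge> 4"
  using power_mono[OF q_ge_2, of 2] by simp

lemma g_nonzero: "g \<noteq> 0"
proof -
  have "g ^ 1 \<in> {x. x ^ (q\<^sup>2) = x} - {0}" unfolding powers_g by blast
  then show ?thesis by simp
qed

lemma g_power_order: "g ^ (q\<^sup>2 - 1) = 1"
proof -
  have "g ^ 1 \<in> {x. x ^ (q\<^sup>2) = x} - {0}" unfolding powers_g by blast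
  then have "g ^ (q\<^sup>2) = g" by simp
  moreover have "Suc (q\<^sup>2 - 1) = q\<^sup>2" using q2_ge by simp
  then have "g ^ (q\<^sup>2) = g * g ^ (q\<^sup>2 - 1)" by (metis power_Suc)
  ultimately show ?thesis using g_nonzero by simp
qed

lemma g_power_image: "(\<lambda>i. g ^ i) ` {..<q\<^sup>2 - 1} = {x. x ^ (q\<^sup>2) = x} - {0}"
proof -
  have "g ^ i = g ^ (i mod (q\<^sup>2 - 1))" for i
  proof -
    have "g ^ i = (g ^ (q\<^sup>2 - 1)) ^ (i div (q\<^sup>2 - 1)) * g ^ (i mod (q\<^sup>2 - 1))"
      unfolding power_mult[symmetric] power_add[symmetric] by simp
    then show ?thesis by (simp only: g_power_order power_one mult_1)
  qed
  moreover have "i mod (q\<^sup>2 - 1) < q\<^sup>2 - 1" for i using q2_ge by (intro mod_less_divisor) simp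
  ultimately have "range (\<lambda>i. g ^ i) \<subseteq> (\<lambda>i. g ^ i) ` {..<q\<^sup>2 - 1}" by blast
  then show ?thesis unfolding powers_g by blast
qed

lemma inj_g_power: "inj_on (\<lambda>i. g ^ i) {..<q\<^sup>2 - 1}"
proof (rule eq_card_imp_inj_on)
  have "card {x :: 'a. x ^ (q\<^sup>2) = x} = q\<^sup>2"
    using q2_ge even_q by (intro card_fixed_power) auto
  moreover have "(0 :: 'a) \<in> {x. x ^ (q\<^sup>2) = x}" using q2_ge q_ge_2 by simp
  ultimately show "card ((\<lambda>i. g ^ i) ` {..<q\<^sup>2 - 1}) = card {..<q\<^sup>2 - 1}"
    unfolding g_power_image by simp
qed simp

text \<open>Here w^(q+1) is the norm of w. For x = g^i and y = g^j the condition N(x y + 1) = c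
  depends on i + j only, so the relation is recorded by a set of discrete logarithms.\<close>

definition norm_exponents :: "'a \<Rightarrow> nat set" where
  "norm_exponents c = {i. i < q\<^sup>2 - 1 \<and> (g ^ i + 1) ^ (q + 1) = c}"

lemma norm_exponents_subset: "norm_exponents c \<subseteq> {..<q\<^sup>2 - 1}"
  by (auto simp: norm_exponents_def)

text \<open>A nonzero element of the smaller field is the norm of q + 1 elements. At most one is
  lost: w = 1 would need the power of g equal to w + 1 to be 0.\<close>

lemma card_norm_exponents:
  assumes "a \<in> subfield_q" "b \<in> subfield_q" "a \<noteq> b"
  shows "card (norm_exponents (a + b)) \<ge> q"
proof -
  let ?c = "a + b"
  let ?W = "{w. w ^ (q + 1) = ?c}"
  have c: "?c \<noteq> 0" using assms(3) add_self[of b] by (metis add_right_cancel)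
  have cq: "?c ^ q = ?c" using assms by (simp add: subfield_q_def add_power_q)
  have W: "card ?W = q + 1"
    using c even_q by (intro card_power_eq) auto
  have "?W - {1} \<subseteq> (\<lambda>i. g ^ i + 1) ` norm_exponents ?c"
  proof
    fix w assume w: "w \<in> ?W - {1}"
    then have w1: "w ^ (q + 1) = ?c" and "w \<noteq> 1" "w \<noteq> 0" using c by auto
    \<comment> \<open>Raising the norm equation to the power q fixes its right side, and comparing
      both versions shows that w lies in the field with q^2 elements.\<close>
    have "w ^ q * w ^ (q\<^sup>2) = w ^ ((q + 1) * q)"
      by (simp add: power2_eq_square flip: power_add)
    also have "\<dots> = (w ^ (q + 1)) ^ q" by (rule power_mult)
    also have "\<dots> = w ^ (q + 1)" unfolding w1 by (rule cq)
    also have "\<dots> = w ^ q * w" by simp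
    finally have "w ^ (q\<^sup>2) = w" using \<open>w \<noteq> 0\<close> by simp
    then have "(w + 1) ^ (q\<^sup>2) = w + 1" by (simp add: add_power_q)
    moreover have "w + 1 \<noteq> 0" using \<open>w \<noteq> 1\<close> add_self[of 1] by (metis add_right_cancel)
    ultimately have "w + 1 \<in> (\<lambda>i. g ^ i) ` {..<q\<^sup>2 - 1}" unfolding g_power_image by simp
    then obtain i where i: "i < q\<^sup>2 - 1" "w + 1 = g ^ i" by blast
    then have "g ^ i + 1 = w" using add_self[of 1] by (metis add.assoc add.right_neutral)
    then show "w \<in> (\<lambda>i. g ^ i + 1) ` norm_exponents ?c"
      using i w1 by (auto simp: norm_exponents_def intro!: image_eqI[of _ _ i])
  qed
  moreover have "finite (norm_exponents ?c)"
    using norm_exponents_subset finite_subset by blast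
  ultimately have "card (?W - {1}) \<le> card (norm_exponents ?c)"
    by (metis card_image_le card_mono finite_imageI le_trans)
  moreover have "card (?W - {1}) \<ge> q"
    using W diff_card_le_card_Diff[of "{1}" ?W] by simp
  ultimately show ?thesis by simp
qed

text \<open>By \<open>add\<close>, r i j is a term in i plus a term in j, as an identity of numbers
  and not just of residues. Hence g^(r i j) is a product x_i y_j, and dividing y_j by g^(r 0 0)
  makes up for counting r 0 0 twice.\<close>

lemma norm_exponents_no_K33:
  fixes a b :: "nat \<Rightarrow> 'a" and r :: "nat \<Rightarrow> nat \<Rightarrow> nat"
  assumes r: "\<And>i j. i < 3 \<Longrightarrow> j < 3 \<Longrightarrow> r i j \<in> norm_exponents (a i + b j)"
    and add: "\<And>i j. i < 3 \<Longrightarrow> j < 3 \<Longrightarrow> r i j + r 0 0 = r i 0 + r 0 j"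
    and inj: "inj_on (\<lambda>i. r i 0) {..<3}" "inj_on (r 0) {..<3}"
  shows False
proof (rule norm_relation_no_K33[where \<sigma> = "\<lambda>x. x ^ q" and a = a and b = b
    and x = "\<lambda>i. g ^ r i 0" and y = "\<lambda>j. g ^ r 0 j / g ^ r 0 0"])
  have char: "prime CHAR('a)" by (simp add: char2)
  show "(x - y) ^ q = x ^ q - y ^ q" "inj (\<lambda>x :: 'a. x ^ q)" for x y :: 'a
    using diff_power_char[OF char q_power_char(1)] inj_power_char[OF char q_power_char(1)] by auto
  have lt: "r i j < q\<^sup>2 - 1" if "i < 3" "j < 3" for i j
    using r[OF that] norm_exponents_subset by blast
  have cancel: "r i j = r i' j'" if "g ^ r i j = g ^ r i' j'" "i < 3" "j < 3" "i' < 3" "j' < 3" for i j i' j'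
    using inj_onD[OF inj_g_power that(1)] lt that by simp
  show "inj_on (\<lambda>i. g ^ r i 0) {..<3}"
    using cancel inj_onD[OF inj(1)] by (intro inj_onI) auto
  show "inj_on (\<lambda>j. g ^ r 0 j / g ^ r 0 0) {..<3}"
    using cancel inj_onD[OF inj(2)] g_nonzero by (intro inj_onI) auto
  fix i j :: nat assume ij: "i < 3" "j < 3"
  have "g ^ r i 0 * (g ^ r 0 j / g ^ r 0 0) = g ^ r i j"
    using arg_cong[OF add[OF ij], of "\<lambda>n. g ^ n"] g_nonzero by (simp add: power_add field_simps)
  then show "(g ^ r i 0 * (g ^ r 0 j / g ^ r 0 0) + 1)
      * ((g ^ r i 0) ^ q * (g ^ r 0 j / g ^ r 0 0) ^ q + 1) = a i + b j"
    using r[OF ij] by (simp add: norm_exponents_def add_power_q flip: power_mult_distrib)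
qed

end

lemma quadratic_tower_exists:
  assumes "CHAR('a :: alg_closed_field) = 2" "k > 0"
  shows "\<exists>g :: 'a. quadratic_tower k (2 ^ k) g"
proof -
  have q: "(2 ^ k :: nat)\<^sup>2 = CHAR('a) ^ (k * 2)" unfolding assms(1) by (rule power_mult[symmetric])
  have "monom 1 ((2 ^ k)\<^sup>2) - [:0, 1 :: 'a:] \<noteq> 0"
  proof
    assume "monom 1 ((2 ^ k)\<^sup>2) - [:0, 1 :: 'a:] = 0"
    then have "degree (monom (1 :: 'a) ((2 ^ k)\<^sup>2)) = degree [:0, 1 :: 'a:]" by simp
    then show False using assms(2) by (simp add: degree_monom_eq)
  qed
  then have "finite {x :: 'a. x ^ ((2 ^ k)\<^sup>2) = x}"
    using poly_roots_finite[of "monom 1 ((2 ^ k)\<^sup>2) - [:0, 1 :: 'a:]"] by (simp add: poly_monom)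
  then obtain g :: 'a where "{x. x ^ ((2 ^ k)\<^sup>2) = x} - {0} = range (\<lambda>i. g ^ i)"
    using power_char_power_fixed_generator[where ?'a = 'a and m = "k * 2"] assms(1)
    unfolding q by auto
  then show ?thesis using assms by (auto simp: quadratic_tower_def)
qed

section \<open>Regular graphs without \<open>K\<^sub>3\<^sub>,\<^sub>3\<close>\<close>

text \<open>An arbitrary vertex type allows products and disjoint sums as vertex sets. Disjointness
  of the two triples follows from irreflexivity of \<open>adj\<close>.\<close>

definition K33_free_regular :: "'v set \<Rightarrow> ('v \<Rightarrow> 'v \<Rightarrow> bool) \<Rightarrow> nat \<Rightarrow> bool" where
  "K33_free_regular V adj d \<longleftrightarrow> finite V \<and> (\<forall>u\<in>V. \<forall>v\<in>V. adj u v \<longrightarrow> adj v u) \<and> (\<forall>v\<in>V. \<not> adj v v)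
    \<and> (\<forall>v\<in>V. card {w \<in> V. adj v w} = d)
    \<and> \<not> (\<exists>(x :: nat \<Rightarrow> 'v) (y :: nat \<Rightarrow> 'v). x ` {..<3} \<subseteq> V \<and> y ` {..<3} \<subseteq> V \<and> inj_on x {..<3} \<and> inj_on y {..<3}
          \<and> (\<forall>i<3. \<forall>j<3. adj (x i) (y j)))"

text \<open>The forbidden graph is connected: the summand of x 0 determines that of every y j, and
  these determine that of every x i.\<close>

lemma K33_free_regular_disjoint_sum:
  assumes 1: "K33_free_regular V adj d" and 2: "K33_free_regular W adj' d"
  shows "K33_free_regular (V <+> W) (rel_sum adj adj') d"
proof -
  have "card {w \<in> V <+> W. rel_sum adj adj' v w} = d" if "v \<in> V <+> W" for v
  proof (cases v)
    case (Inl a)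
    then have "{w \<in> V <+> W. rel_sum adj adj' v w} = Inl ` {w \<in> V. adj a w}" by auto
    then show ?thesis using 1 that Inl by (auto simp: K33_free_regular_def card_image)
  next
    case (Inr a)
    then have "{w \<in> V <+> W. rel_sum adj adj' v w} = Inr ` {w \<in> W. adj' a w}" by auto
    then show ?thesis using 2 that Inr by (auto simp: K33_free_regular_def card_image)
  qed
  moreover have False
    if xy: "x ` {..<3} \<subseteq> V <+> W" "y ` {..<3} \<subseteq> V <+> W" "inj_on x {..<3}" "inj_on y {..<3}"
      "\<forall>i<3. \<forall>j<3. rel_sum adj adj' (x i) (y j)" for x y :: "nat \<Rightarrow> 'a + 'b"
  proof (cases "x 0")
    case (Inl a)
    then have "\<exists>b. y j = Inl b \<and> b \<in> V" if "j < 3" for j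
      using xy(5)[rule_format, of 0 j] xy(2) that by (cases "y j") auto
    then obtain y' where y': "\<And>j. j < 3 \<Longrightarrow> y j = Inl (y' j)" "\<And>j. j < 3 \<Longrightarrow> y' j \<in> V" by metis
    then have "\<exists>b. x i = Inl b \<and> b \<in> V" if "i < 3" for i
      using xy(5)[rule_format, of i 0] xy(1) that by (cases "x i") auto
    then obtain x' where x': "\<And>i. i < 3 \<Longrightarrow> x i = Inl (x' i)" "\<And>i. i < 3 \<Longrightarrow> x' i \<in> V" by metis
    have "\<forall>i<3. \<forall>j<3. adj (x' i) (y' j)" using xy(5) x'(1) y'(1) by simp
    moreover have "inj_on x' {..<3}" "inj_on y' {..<3}"
      using xy(3,4) x'(1) y'(1) by (auto simp: inj_on_def)
    moreover have "x' ` {..<3} \<subseteq> V" "y' ` {..<3} \<subseteq> V" using x'(2) y'(2) by auto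
    ultimately show False using 1 unfolding K33_free_regular_def by blast
  next
    case (Inr a)
    then have "\<exists>b. y j = Inr b \<and> b \<in> W" if "j < 3" for j
      using xy(5)[rule_format, of 0 j] xy(2) that by (cases "y j") auto
    then obtain y' where y': "\<And>j. j < 3 \<Longrightarrow> y j = Inr (y' j)" "\<And>j. j < 3 \<Longrightarrow> y' j \<in> W" by metis
    then have "\<exists>b. x i = Inr b \<and> b \<in> W" if "i < 3" for i
      using xy(5)[rule_format, of i 0] xy(1) that by (cases "x i") auto
    then obtain x' where x': "\<And>i. i < 3 \<Longrightarrow> x i = Inr (x' i)" "\<And>i. i < 3 \<Longrightarrow> x' i \<in> W" by metis
    have "\<forall>i<3. \<forall>j<3. adj' (x' i) (y' j)" using xy(5) x'(1) y'(1) by simp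
    moreover have "inj_on x' {..<3}" "inj_on y' {..<3}"
      using xy(3,4) x'(1) y'(1) by (auto simp: inj_on_def)
    moreover have "x' ` {..<3} \<subseteq> W" "y' ` {..<3} \<subseteq> W" using x'(2) y'(2) by auto
    ultimately show False using 2 unfolding K33_free_regular_def by blast
  qed
  moreover have "\<forall>u\<in>V <+> W. \<forall>v\<in>V <+> W. rel_sum adj adj' u v \<longrightarrow> rel_sum adj adj' v u"
    "\<forall>v\<in>V <+> W. \<not> rel_sum adj adj' v v" "finite (V <+> W)"
    using 1 2 unfolding K33_free_regular_def by auto
  ultimately show ?thesis unfolding K33_free_regular_def by blast
qed

lemma sum_degree:
  assumes "simple_graph G"
  shows "(\<Sum>v\<in>verts G. Defs.degree G v) = 2 * card (edges G)"
proof -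
  have fin: "finite (verts G)" and e: "\<And>e. e \<in> edges G \<Longrightarrow> e \<subseteq> verts G \<and> card e = 2"
    using assms by (auto simp: simple_graph_def)
  have "edges G \<subseteq> Pow (verts G)" using e by blast
  then have fe: "finite (edges G)" using fin finite_subset by auto
  have "card {v \<in> verts G. v \<in> e'} = 2" if "e' \<in> edges G" for e'
  proof -
    have "{v \<in> verts G. v \<in> e'} = e'" using e[OF that] by blast
    then show ?thesis using e[OF that] by simp
  qed
  then show ?thesis
    unfolding Defs.degree_def using sum_multicount[OF fin fe] by simp
qed

text \<open>Numbering the vertices turns the relation into a member of
  \<open>rex_candidates\<close>, whose edges are counted by the handshake identity.\<close>

lemma rex_ge_K33_free_regular:
  fixes V :: "'v set"
  assumes "K33_free_regular V adj d"
  shows "card V * d \<le> 2 * rex (card V) (complete_bipartite 3 3)"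
proof -
  have fin: "finite V" using assms by (simp add: K33_free_regular_def)
  have sym: "adj u v \<longleftrightarrow> adj v u" if "u \<in> V" "v \<in> V" for u v
    using assms that by (auto simp: K33_free_regular_def)
  obtain f where f: "bij_betw f V {..<card V}"
    using fin by (metis ex_bij_betw_finite_nat lessThan_atLeast0)
  then have inj: "inj_on f V" and im: "f ` V = {..<card V}" by (auto simp: bij_betw_def)
  have f_eq: "f u = f v \<longleftrightarrow> u = v" if "u \<in> V" "v \<in> V" for u v
    using inj that by (auto simp: inj_on_def)
  define E where "E = {{f u, f v} | u v. u \<in> V \<and> v \<in> V \<and> adj u v}"
  define G where "G = ({..<card V}, E)"
  have edge_iff: "{f u, f v} \<in> E \<longleftrightarrow> adj u v" if "u \<in> V" "v \<in> V" for u v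
  proof
    assume "{f u, f v} \<in> E"
    then obtain u' v' where "{f u, f v} = {f u', f v'}" "u' \<in> V" "v' \<in> V" "adj u' v'"
      unfolding E_def by blast
    then show "adj u v" using that f_eq sym[of u' v'] by (auto simp: doubleton_eq_iff)
  qed (use that in \<open>auto simp: E_def\<close>)
  have simple: "simple_graph G"
  proof -
    have "e \<subseteq> {..<card V} \<and> card e = 2" if e: "e \<in> E" for e
    proof -
      obtain u v where uv: "e = {f u, f v}" "u \<in> V" "v \<in> V" "adj u v"
        using e unfolding E_def by blast
      then have "f u \<noteq> f v" using assms f_eq by (auto simp: K33_free_regular_def)
      then show ?thesis using uv unfolding im[symmetric] by simp
    qed
    then show ?thesis by (simp add: simple_graph_def G_def)
  qed
  have deg: "Defs.degree G (f v) = d" if "v \<in> V" for v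
  proof -
    have "{e \<in> E. f v \<in> e} = (\<lambda>w. {f v, f w}) ` {w \<in> V. adj v w}"
    proof (intro subset_antisym subsetI)
      fix e assume "e \<in> {e \<in> E. f v \<in> e}"
      then obtain a b where ab: "e = {f a, f b}" "a \<in> V" "b \<in> V" "adj a b" "f v = f a \<or> f v = f b"
        unfolding E_def by blast
      then have "v = a \<or> v = b" using f_eq that by blast
      then show "e \<in> (\<lambda>w. {f v, f w}) ` {w \<in> V. adj v w}"
        using ab sym by (auto simp: insert_commute)
    qed (use that in \<open>auto simp: E_def\<close>)
    moreover have "inj_on (\<lambda>w. {f v, f w}) {w \<in> V. adj v w}"
      using f_eq that by (auto intro!: inj_onI simp: doubleton_eq_iff)
    ultimately show ?thesis
      using assms that by (simp add: Defs.degree_def G_def card_image K33_free_regular_def)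
  qed
  have deg': "Defs.degree G n = d" if "n \<in> verts G" for n
  proof -
    have "n \<in> f ` V" using that im by (simp add: G_def)
    then show ?thesis using deg by blast
  qed
  then have reg: "regular G" unfolding regular_def by blast
  have "\<not> contains_copy G (complete_bipartite 3 3)"
  proof
    assume "contains_copy G (complete_bipartite 3 3)"
    then obtain H h where H: "verts H \<subseteq> {..<card V}" "edges H \<subseteq> E"
      and h: "bij_betw h (verts H) ({..<3} <+> {..<3})"
      and he: "\<And>u v. u \<in> verts H \<Longrightarrow> v \<in> verts H \<Longrightarrow>
        {u, v} \<in> edges H \<longleftrightarrow> {h u, h v} \<in> edges (complete_bipartite 3 3)"
      unfolding contains_copy_def subgraph_def isomorphic_def G_def
      by (auto simp: complete_bipartite_def)
    define g where "g = inv_into (verts H) h"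
    define f' where "f' = inv_into V f"
    have g: "g s \<in> verts H" "h (g s) = s" if "s \<in> {..<3} <+> {..<3}" for s
      using h that unfolding g_def by (auto simp: bij_betw_def inv_into_into f_inv_into_f)
    have f': "f' n \<in> V" "f (f' n) = n" if "n < card V" for n
      using im that unfolding f'_def by (auto simp: inv_into_into f_inv_into_f)
    let ?x = "\<lambda>i::nat. f' (g (Inl i))" and ?y = "\<lambda>j::nat. f' (g (Inr j))"
    have gl: "g s < card V" if "s \<in> {..<3} <+> {..<3}" for s using g(1)[OF that] H(1) by auto
    have eq: "s = t" if "f' (g s) = f' (g t)" "s \<in> {..<3} <+> {..<3}" "t \<in> {..<3} <+> {..<3}" for s t
      using that f'(2)[OF gl] g(2) by metis
    have "adj (?x i) (?y j)" if ij: "i < 3" "j < 3" for i j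
    proof -
      have mem: "Inl i \<in> {..<3} <+> {..<3}" "Inr j \<in> {..<3} <+> {..<3}" using ij by auto
      have "{g (Inl i), g (Inr j)} \<in> edges H"
        using he[OF g(1)[OF mem(1)] g(1)[OF mem(2)]] g(2)[OF mem(1)] g(2)[OF mem(2)] ij
        by (auto simp: complete_bipartite_def)
      then have "{f (?x i), f (?y j)} \<in> E"
        using H(2) f'(2)[OF gl[OF mem(1)]] f'(2)[OF gl[OF mem(2)]] by auto
      then show ?thesis using edge_iff f'(1) gl mem by blast
    qed
    moreover have "?x ` {..<3} \<subseteq> V" "?y ` {..<3} \<subseteq> V" using f'(1) gl by auto
    moreover have "inj_on ?x {..<3}" "inj_on ?y {..<3}" by (auto intro!: inj_onI dest: eq)
    ultimately show False using assms unfolding K33_free_regular_def by blast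
  qed
  then have "G \<in> rex_candidates (card V) (complete_bipartite 3 3)"
    using simple reg by (simp add: rex_candidates_def) (simp add: G_def)
  then have "card (edges G) \<le> rex (card V) (complete_bipartite 3 3)"
    unfolding rex_def by (intro Max_ge finite_rex_candidates) blast
  moreover have "card V * d = 2 * card (edges G)"
  proof -
    have "(\<Sum>v\<in>verts G. Defs.degree G v) = (\<Sum>v\<in>verts G. d)"
      using deg' by (rule sum.cong[OF refl])
    then show ?thesis using sum_degree[OF simple] by (simp add: G_def)
  qed
  ultimately show ?thesis by simp
qed

section \<open>Sums modulo M and layered graphs\<close>

lemma bij_betw_add_mod:
  fixes x M :: nat
  shows "bij_betw (\<lambda>y. (x + y) mod M) {..<M} {..<M}"
proof -
  have "((x + y) mod M + (M - x mod M)) mod M = y" if "y < M" for y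
  proof -
    have "x mod M < M" using that by simp
    moreover have "M * (x div M) + x mod M = x" by simp
    ultimately have "(x + y) + (M - x mod M) = y + (M + M * (x div M))" by linarith
    also have "\<dots> = y + M * Suc (x div M)" by simp
    finally have "(x + y) + (M - x mod M) = y + M * Suc (x div M)" .
    then have "((x + y) + (M - x mod M)) mod M = y" using that by (simp del: mult_Suc_right)
    then show ?thesis by (simp add: mod_add_left_eq)
  qed
  then have "inj_on (\<lambda>y. (x + y) mod M) {..<M}"
    by (intro inj_on_inverseI[where g = "\<lambda>s. (s + (M - x mod M)) mod M"]) auto
  moreover have "(\<lambda>y. (x + y) mod M) ` {..<M} \<subseteq> {..<M}" by auto
  ultimately show ?thesis by (simp add: bij_betw_def endo_inj_surj)
qed

lemma card_add_mod_vimage: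
  fixes x M :: nat
  assumes "S \<subseteq> {..<M}"
  shows "card {y \<in> {..<M}. (x + y) mod M \<in> S} = card S"
proof -
  let ?f = "\<lambda>y. (x + y) mod M"
  have f: "inj_on ?f {..<M}" "?f ` {..<M} = {..<M}"
    using bij_betw_add_mod unfolding bij_betw_def by blast+
  have "?f ` {y \<in> {..<M}. ?f y \<in> S} = S"
  proof (intro subset_antisym subsetI)
    fix s assume s: "s \<in> S"
    then have "s \<in> ?f ` {..<M}" using assms f(2) by blast
    then show "s \<in> ?f ` {y \<in> {..<M}. ?f y \<in> S}" using s by blast
  qed auto
  then show ?thesis using card_image[OF inj_on_subset[OF f(1)]] by (metis (no_types, lifting) mem_Collect_eq subsetI)
qed

context quadratic_tower
begin

text \<open>All admissible residues are below q^2 - 1, so a sum of two of them is below M.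
  Congruences modulo M between such sums are therefore equalities, as
  \<open>norm_exponents_no_K33\<close> demands.\<close>

lemma layered_graph:
  assumes Lay: "Lay \<subseteq> subfield_q" and c: "c \<le> q" and M: "M \<ge> 2 * (q\<^sup>2 - 1)"
  shows "\<exists>adj. K33_free_regular (Lay \<times> {..<M}) adj ((card Lay - 1) * c)"
proof -
  have "finite subfield_q" using card_subfield_q q_ge_2 by (intro card_ge_0_finite) simp
  then have fin: "finite Lay" using Lay finite_subset by blast
  \<comment> \<open>The chosen subset depends on the sum of the two layers alone, which keeps
    adjacency symmetric.\<close>
  have "\<exists>S. c \<le> card (norm_exponents s) \<longrightarrow> S \<subseteq> norm_exponents s \<and> card S = c" for s
    using obtain_subset_with_card_n by meson
  then obtain C where C: "\<And>s. c \<le> card (norm_exponents s) \<Longrightarrow> C s \<subseteq> norm_exponents s \<and> card (C s) = c"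
    by metis
  have C: "C (a + b) \<subseteq> norm_exponents (a + b)" "card (C (a + b)) = c"
    if "a \<in> Lay" "b \<in> Lay" "a \<noteq> b" for a b
    using C card_norm_exponents[of a b] that Lay c by (auto dest: order_trans)
  have lt: "i < q\<^sup>2 - 1" if "i \<in> norm_exponents s" for i s
    using that norm_exponents_subset by blast
  define adj where "adj = (\<lambda>(a, x) (b, y). a \<noteq> b \<and> (x + y) mod M \<in> C (a + b))"
  have "card {w \<in> Lay \<times> {..<M}. adj v w} = (card Lay - 1) * c" if v: "v \<in> Lay \<times> {..<M}" for v
  proof -
    obtain a x where ax: "v = (a, x)" "a \<in> Lay" using v by blast
    let ?Y = "\<lambda>b. {y \<in> {..<M}. (x + y) mod M \<in> C (a + b)}"
    have "{w \<in> Lay \<times> {..<M}. adj v w} = Sigma (Lay - {a}) ?Y"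
      by (auto simp: adj_def ax)
    moreover have "card (?Y b) = c" if b: "b \<in> Lay - {a}" for b
    proof -
      have "C (a + b) \<subseteq> {..<M}"
        using C(1)[of a b] ax b lt M by fastforce
      then show ?thesis using card_add_mod_vimage C(2)[of a b] ax b by auto
    qed
    ultimately show ?thesis using fin ax by simp
  qed
  moreover have False
    if vw: "v ` {..<3} \<subseteq> Lay \<times> {..<M}" "w ` {..<3} \<subseteq> Lay \<times> {..<M}" "inj_on v {..<3}" "inj_on w {..<3}"
      "\<forall>i<3. \<forall>j<3. adj (v i) (w j)" for v w :: "nat \<Rightarrow> 'a \<times> nat"
  proof -
    define a x b y where "a = fst \<circ> v" and "x = snd \<circ> v" and "b = fst \<circ> w" and "y = snd \<circ> w"
    have v: "v i = (a i, x i)" and w: "w i = (b i, y i)" for i by (simp_all add: a_def x_def b_def y_def)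
    define r where "r = (\<lambda>i j. (x i + y j) mod M)"
    have mem: "a i \<in> Lay" "x i < M" "b i \<in> Lay" "y i < M" if "i < 3" for i
      using vw(1,2) v w that by (auto simp: image_subset_iff)
    have r: "r i j \<in> norm_exponents (a i + b j)" if "i < 3" "j < 3" for i j
      using vw(5) mem that C(1)[of "a i" "b j"] by (auto simp: adj_def v w r_def)
    have add: "r i j + r 0 0 = r i 0 + r 0 j" if ij: "i < 3" "j < 3" for i j
    proof -
      have "(r i j + r 0 0) mod M = (r i 0 + r 0 j) mod M"
        unfolding r_def mod_add_eq by (simp add: ac_simps)
      moreover have "r i j + r 0 0 < M" "r i 0 + r 0 j < M"
        using lt[OF r[OF ij]] lt[OF r[of 0 0]] lt[OF r[of i 0]] lt[OF r[of 0 j]] ij M by linarith+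
      ultimately show ?thesis by simp
    qed
    have "i = i'" if "i < 3" "i' < 3" "r i 0 = r i' 0" for i i'
    proof -
      have "(y 0 + x i) mod M = (y 0 + x i') mod M" using that(3) by (simp add: r_def add.commute)
      then have "x i = x i'"
        using bij_betw_add_mod[of "y 0" M] mem that by (auto simp: bij_betw_def inj_on_def)
      \<comment> \<open>An exponent determines the value of the norm, so equal exponents force equal
        layers as well.\<close>
      moreover have "a i + b 0 = a i' + b 0"
        using r[of i 0] r[of i' 0] that by (auto simp: norm_exponents_def)
      ultimately show ?thesis using vw(3) that v by (auto simp: inj_on_def)
    qed
    moreover have "j = j'" if "j < 3" "j' < 3" "r 0 j = r 0 j'" for j j'
    proof -
      have "y j = y j'"
        using bij_betw_add_mod[of "x 0" M] mem that by (auto simp: bij_betw_def inj_on_def r_def)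
      moreover have "a 0 + b j = a 0 + b j'"
        using r[of 0 j] r[of 0 j'] that by (auto simp: norm_exponents_def)
      ultimately show ?thesis using vw(4) that w by (auto simp: inj_on_def)
    qed
    ultimately show False
      using norm_exponents_no_K33[of r a b, OF r add] by (auto simp: inj_on_def)
  qed
  moreover have "finite (Lay \<times> {..<M})" using fin by simp
  moreover have "adj u v \<Longrightarrow> adj v u" "\<not> adj v v" for u v
    by (auto simp: adj_def add.commute split: prod.splits)
  ultimately show ?thesis
    unfolding K33_free_regular_def by (intro exI[of _ adj]) blast
qed

text \<open>With L layers take L e neighbours per foreign layer, with L + 1 layers take (L - 1) e;
  both degrees are L (L - 1) e, so the disjoint union is regular.\<close>

lemma rex_ge_two_layerings:
  assumes "L * e \<le> q" "L + 1 \<le> q" "n \<ge> 4 * q\<^sup>2 * L + 4 * q\<^sup>2"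
  shows "n * (L * (L - 1) * e) \<le> 2 * rex n (complete_bipartite 3 3)"
proof (cases "L = 0")
  case False
  \<comment> \<open>Since n = L (M1 + M2) + M2, \<open>M2\<close> must be congruent to n modulo L;
    this is the least such value that is at least 2 q^2.\<close>
  define t M2 M1 where "t = n - 2 * q\<^sup>2" and "M2 = 2 * q\<^sup>2 + t mod L" and "M1 = t div L - M2"
  have "t mod L < L" using False by simp
  have "L * L \<le> q\<^sup>2" using assms(2) unfolding power2_eq_square by (intro mult_mono) auto
  have "L * (4 * q\<^sup>2 + L) \<le> t"
    using assms(3) \<open>L * L \<le> q\<^sup>2\<close> by (simp add: t_def algebra_simps)
  then have "4 * q\<^sup>2 + L \<le> t div L" using False by (simp add: less_eq_div_iff_mult_less_eq mult.commute)
  then have M: "M1 \<ge> 2 * q\<^sup>2" "M2 \<ge> 2 * q\<^sup>2" "t div L = M1 + M2"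
    using \<open>t mod L < L\<close> by (auto simp: M1_def M2_def)
  have "n = 2 * q\<^sup>2 + t" using assms(3) by (simp add: t_def)
  also have "t = L * (M1 + M2) + t mod L" using M(3) by (metis mult_div_mod_eq)
  finally have n: "n = L * M1 + (L + 1) * M2" by (simp add: M2_def algebra_simps)
  obtain A where A: "A \<subseteq> subfield_q" "card A = L"
    using obtain_subset_with_card_n[of L subfield_q] card_subfield_q assms(2) by auto
  obtain B where B: "B \<subseteq> subfield_q" "card B = L + 1"
    using obtain_subset_with_card_n[of "L + 1" subfield_q] card_subfield_q assms(2) by auto
  have M': "2 * (q\<^sup>2 - 1) \<le> M1" "2 * (q\<^sup>2 - 1) \<le> M2" using M by auto
  have "(L - 1) * e \<le> q" using assms(1) by (metis diff_le_self le_trans mult_le_mono1)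
  then obtain adj adj' where
    "K33_free_regular (A \<times> {..<M1}) adj ((L - 1) * (L * e))"
    "K33_free_regular (B \<times> {..<M2}) adj' (L * ((L - 1) * e))"
    using layered_graph[OF A(1) assms(1) M'(1)] layered_graph[OF B(1) \<open>(L - 1) * e \<le> q\<close> M'(2)]
    unfolding A(2) B(2) by auto
  then have reg: "K33_free_regular (A \<times> {..<M1} <+> B \<times> {..<M2}) (rel_sum adj adj') (L * (L - 1) * e)"
    by (intro K33_free_regular_disjoint_sum) (simp_all add: ac_simps)
  have "finite A" "finite B" using A(2) B(2) False by (auto intro: card_ge_0_finite)
  then have "card (A \<times> {..<M1} <+> B \<times> {..<M2}) = n"
    by (simp add: card_Plus card_cartesian_product A B n)
  then show ?thesis using rex_ge_K33_free_regular[OF reg] by simp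
qed simp

end

section \<open>Choice of the parameters\<close>

lemma rex_ge_power_two:
  assumes "k > 0" "q = 2 ^ k" "L * e \<le> q" "L + 1 \<le> q" "n \<ge> 4 * q\<^sup>2 * L + 4 * q\<^sup>2"
  shows "n * (L * (L - 1) * e) \<le> 2 * rex n (complete_bipartite 3 3)"
proof -
  have "CHAR(bit alg_closure) = 2" by (simp add: CHAR_bit)
  then obtain g :: "bit alg_closure" where "quadratic_tower k q g"
    using quadratic_tower_exists assms(1,2) by blast
  from quadratic_tower.rex_ge_two_layerings[OF this assms(3-5)] show ?thesis .
qed

text \<open>With about q/e layers the degree is about q^2/e. The lower bound on n leaves room for
  both parts (9/2 against an asymptotic 4), and the gap between 169 and 196 absorbs
  rounding.\<close>

lemma rex_ge_degree:
  assumes q: "q = 2 ^ k" "q \<ge> 1024" and e: "1 \<le> e" "e \<le> 3"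
    and lower: "9 * q ^ 3 \<le> 2 * e * n" and upper: "n\<^sup>2 * e ^ 3 \<le> 169 * q ^ 6"
  shows "\<exists>d. n * d \<le> 2 * rex n (complete_bipartite 3 3) \<and> n\<^sup>2 \<le> 196 * d ^ 3"
proof (intro exI conjI)
  define L where "L = (q - 1) div e"
  have L: "L * e \<le> q - 1" "q - 1 < L * e + e"
    using dividend_less_times_div[of e "q - 1"] e(1) by (simp_all add: L_def ac_simps)
  have "L \<le> q - 1" unfolding L_def by (rule div_le_dividend)
  have "k > 0" using q by (cases k) auto
  have "q\<^sup>2 * (8 * (q + 2)) \<le> q\<^sup>2 * (9 * q)" using q(2) by (intro mult_le_mono2) simp
  then have cubic: "8 * (q\<^sup>2 * (q + 2)) \<le> 9 * q ^ 3"
    by (simp add: power2_eq_square power3_eq_cube algebra_simps)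
  have "e * (4 * q\<^sup>2 * L + 4 * q\<^sup>2) = 4 * q\<^sup>2 * (L * e + e)" by (simp add: algebra_simps)
  also have "\<dots> \<le> 4 * q\<^sup>2 * (q + 2)" using L e q(2) by (intro mult_le_mono) auto
  also have "\<dots> \<le> e * n" using cubic lower by simp
  finally have n: "4 * q\<^sup>2 * L + 4 * q\<^sup>2 \<le> n" using e(1) by simp
  show "n * (L * (L - 1) * e) \<le> 2 * rex n (complete_bipartite 3 3)"
    using L \<open>L \<le> q - 1\<close> q(2) by (intro rex_ge_power_two[OF \<open>k > 0\<close> q(1) _ _ n]) auto
  let ?d = "L * (L - 1) * e"
  \<comment> \<open>L e is at least q - e, so both factors are at least q - 2 e, and e is at most
    3.\<close>
  have "(q - 6) * (q - 6) \<le> (L * e) * (L * e - e)" using L e by (intro mult_le_mono) auto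
  also have "\<dots> = ?d * e" by (simp add: algebra_simps)
  finally have "((q - 6)\<^sup>2) ^ 3 \<le> (?d * e) ^ 3" unfolding power2_eq_square by (rule power_mono) simp
  then have "(q - 6) ^ 6 \<le> ?d ^ 3 * e ^ 3" by (simp add: power_mult_distrib flip: power_mult)
  moreover have "(99 * q) ^ 6 \<le> (100 * (q - 6)) ^ 6" using q(2) by (intro power_mono) auto
  then have "169 * q ^ 6 \<le> 196 * (q - 6) ^ 6" by (simp add: power_mult_distrib)
  ultimately have "n\<^sup>2 * e ^ 3 \<le> (196 * ?d ^ 3) * e ^ 3" using upper by linarith
  then show "n\<^sup>2 \<le> 196 * ?d ^ 3" using e(1) by simp
qed

text \<open>For \<open>e \<in> {1, 2, 3}\<close> the lower and upper hypotheses of \<open>rex_ge_degree\<close> confine \<open>n / q\<^sup>3\<close> to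
  intervals, and those of \<open>(q, 1)\<close>, \<open>(2 q, 3)\<close>, \<open>(2 q, 2)\<close> cover a full factor of \<open>8\<close>.\<close>

lemma rex_ge_degree_eventually:
  assumes "n \<ge> 36 * 8 ^ 10"
  shows "\<exists>d. n * d \<le> 2 * rex n (complete_bipartite 3 3) \<and> n\<^sup>2 \<le> 196 * d ^ 3"
proof -
  have "n < 8 ^ n" by (rule less_exp[THEN less_le_trans]) (simp add: power_mono)
  then have "2 * n < 72 * 8 ^ n" by simp
  \<comment> \<open>Minimality places n between (9/2) Q^3 and 36 Q^3 for Q = 2^m.\<close>
  define m where "m = (LEAST m. 2 * n < 72 * 8 ^ m)"
  have up: "2 * n < 72 * 8 ^ m" unfolding m_def using \<open>2 * n < 72 * 8 ^ n\<close> by (rule LeastI)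
  have "m \<ge> 10"
  proof (rule ccontr)
    assume "\<not> m \<ge> 10"
    then have "(8::nat) ^ m \<le> 8 ^ 10" by (intro power_increasing) auto
    then show False using up assms by simp
  qed
  then have "m - 1 < m" by simp
  then have "\<not> 2 * n < 72 * 8 ^ (m - 1)" unfolding m_def by (rule not_less_Least)
  moreover have "(8::nat) ^ m = 8 * 8 ^ (m - 1)" using \<open>m \<ge> 10\<close> by (cases m) auto
  ultimately have low: "9 * 8 ^ m \<le> 2 * n" by simp
  define Q :: nat where "Q = 2 ^ m"
  have "(8::nat) = 2 ^ 3" by simp
  then have Q3: "8 ^ m = Q ^ 3" unfolding Q_def by (metis mult.commute power_mult)
  have "(2::nat) ^ 10 \<le> 2 ^ m" using \<open>m \<ge> 10\<close> by (intro power_increasing) auto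
  then have Q: "Q \<ge> 1024" by (simp add: Q_def)
  have sq: "n\<^sup>2 \<le> c\<^sup>2 * Q ^ 6" if "n \<le> c * Q ^ 3" for c
    using power_mono[OF that, of 2] by (simp add: power_mult_distrib flip: power_mult)
  \<comment> \<open>In units of Q^3 the three choices of parameters work on [4.5, 13], [12, 20] and
    [18, 36], so 13 and 20 are valid cut points.\<close>
  consider "n \<le> 13 * Q ^ 3" | "13 * Q ^ 3 \<le> n" "n \<le> 20 * Q ^ 3" | "20 * Q ^ 3 \<le> n" by linarith
  then show ?thesis
  proof cases
    case 1
    then show ?thesis using sq[of 13] low Q
      by (intro rex_ge_degree[where k = m and q = Q and e = 1]) (simp_all add: Q3 Q_def)
  next
    case 2
    then show ?thesis using sq[of 20] Q
      by (intro rex_ge_degree[where k = "Suc m" and q = "2 * Q" and e = 3])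
        (simp_all add: Q_def power_mult_distrib)
  next
    case 3
    then show ?thesis using sq[of 36] up Q
      by (intro rex_ge_degree[where k = "Suc m" and q = "2 * Q" and e = 2])
        (simp_all add: Q3 Q_def power_mult_distrib)
  qed
qed

theorem theorem1p3:
  fixes \<epsilon> :: real
  assumes "\<epsilon> > 0"
  shows "\<exists>C::real. \<forall>\<^sub>F n::nat in sequentially.
    real (rex n (complete_bipartite 3 3)) \<ge>
      1 / (2 * root 3 (14\<^sup>2)) * real n powr (5/3) - C * real n powr (8/5 + \<epsilon>)"
proof (intro exI[of _ 0] eventually_sequentiallyI)
  \<comment> \<open>The main term is reached with no loss, so the error constant is 0.\<close>
  fix n :: nat
  assume n: "36 * 8 ^ 10 \<le> n"
  then obtain d where d: "n * d \<le> 2 * rex n (complete_bipartite 3 3)" "n\<^sup>2 \<le> 196 * d ^ 3"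
    using rex_ge_degree_eventually by blast
  have "real n powr (2/3) = root 3 ((real n)\<^sup>2)"
    using n by (simp add: root_powr_inverse powr_powr flip: powr_numeral)
  also have "\<dots> \<le> root 3 (14\<^sup>2 * real d ^ 3)"
    using d(2) by (intro real_root_le_mono) (simp_all flip: of_nat_le_iff[where ?'a = real])
  also have "\<dots> = root 3 (14\<^sup>2) * real d" by (simp add: real_root_mult real_root_power_cancel)
  finally have root: "real n powr (2/3) \<le> root 3 (14\<^sup>2) * real d" .
  have pos: "root 3 (14\<^sup>2) > (0 :: real)" by simp
  have "real n powr (5/3) = real n * real n powr (2/3)"
    using n by (simp add: powr_mult_base)
  also have "\<dots> \<le> root 3 (14\<^sup>2) * real (n * d)"
    using mult_left_mono[OF root, of "real n"] by (simp add: ac_simps)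
  also have "\<dots> \<le> root 3 (14\<^sup>2) * real (2 * rex n (complete_bipartite 3 3))"
    using d(1) pos by (intro mult_left_mono) (simp_all only: of_nat_le_iff less_imp_le)
  finally show "real (rex n (complete_bipartite 3 3)) \<ge>
      1 / (2 * root 3 (14\<^sup>2)) * real n powr (5/3) - 0 * real n powr (8/5 + \<epsilon>)"
    using pos by (simp add: pos_divide_le_eq ac_simps)
qed

end
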